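(* Let $T$ be a finite tree, let $U$ be a finite set of resources with supports $(Q_x)_{x\in U}$ (subtrees of $T$), let $\mathcal A=(A_e)_{e\in E(T)}$ be a tree-structured hypergraph system on $T$ and $U$, and let $q:E(T)\to\mathbb Z_{>0}$ be a multiplicity function, with $q_e:=q(e)$. The following statements are equivalent: (1) [SDR] $\mathcal A$ admits a $q$-SDR. (2) [Matching] The hypergraph $H(\mathcal A,q)$ has a perfect matching. (3) [Hall] For every $F\subseteq E(T)$, $$\nu\Bigl(\bigcup_{e\in F}E(A_e)\Bigr)\ge\sum_{e\in F}q_e .$$
   Context: Let $T$ be a finite tree and $U$ a finite set, whose elements are called resources. Each $x\in U$ is assigned a subtree (nonempty connected subgraph) $Q_x$ of $T$, called its support. For $t\in V(T)$ the bag at $t$ is $P_t:=\{x\in U: t\in V(Q_x)\}$. A family $\mathcal A=(A_e)_{e\in E(T)}$ is a tree-structured hypergraph system if, for every edge $e=tu$ of $T$, $A_e$ is a hypergraph with vertex set $U$ such that: (i) the loops (singleton hyperedges) of $A_e$ are exactly the sets $\{x\}$ with $x\in P_t\cap P_u$; (ii) every nonloop hyperedge of $A_e$ is a two-element set of the form $\{x,y\}$ with $x\in P_t$ and $y\in P_u$ (not every such pair need be a hyperedge). A $q$-SDR for $\mathcal A$ chooses, for every $e\in E(T)$, $q_e$ hyperedges of $A_e$, such that all chosen hyperedges (over all $e$) are pairwise vertex disjoint, i.e. no resource is used twice. A matching in a hypergraph is a set of pairwise disjoint hyperedges (loops count as singleton hyperedges); $\nu$ denotes the maximum size of a matching, and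 $\nu(\bigcup_{e\in F}E(A_e))$ is the matching number of the hypergraph on $U$ with hyperedge set $\bigcup_{e\in F}E(A_e)$. A perfect matching is a matching covering every vertex. The hypergraph $H(\mathcal A,q)$: for every $e\in E(T)$ introduce $q_e$ new vertices $z_{e,1},\dots,z_{e,q_e}$. The vertex set is $U\cup\{z_{e,i}: e\in E(T),1\le i\le q_e\}$. The hyperedges are the singletons $\{x\}$ for $x\in U$ and the sets $\{z_{e,i}\}\cup a$ for $e\in E(T)$, $1\le i\le q_e$, $a\in E(A_e)$, and no others. *)

theory Defs
  imports Main
begin

section \<open>Finite simple graphs, trees and subtrees\<close>

record 'v ugraph =
  uverts :: "'v set"
  uedges :: "'v set set"

definition simple_graph :: "'v ugraph \<Rightarrow> bool" where
  "simple_graph G \<longleftrightarrow> (\<forall>e\<in>uedges G. e \<subseteq> uverts G \<and> card e = 2)"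

definition walk :: "'v ugraph \<Rightarrow> 'v list \<Rightarrow> bool" where
  "walk G p \<longleftrightarrow> p \<noteq> [] \<and> set p \<subseteq> uverts G \<and> successively (\<lambda>u v. {u, v} \<in> uedges G) p"

definition connected_graph :: "'v ugraph \<Rightarrow> bool" where
  "connected_graph G \<longleftrightarrow>
     uverts G \<noteq> {} \<and>
     (\<forall>u\<in>uverts G. \<forall>v\<in>uverts G. \<exists>p. walk G p \<and> hd p = u \<and> last p = v)"

text \<open>A cycle is listed without repeating its first vertex at the end.\<close>

definition graph_cycle :: "'v ugraph \<Rightarrow> 'v list \<Rightarrow> bool" where
  "graph_cycle G p \<longleftrightarrow>
     walk G p \<and> distinct p \<and> length p \<ge> 3 \<and> {last p, hd p} \<in> uedges G"

definition finite_tree :: "'v ugraph \<Rightarrow> bool" where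
  "finite_tree T \<longleftrightarrow>
     simple_graph T \<and> finite (uverts T) \<and> connected_graph T \<and> (\<nexists>p. graph_cycle T p)"

definition is_subtree :: "'v ugraph \<Rightarrow> 'v ugraph \<Rightarrow> bool" where
  "is_subtree S T \<longleftrightarrow>
     simple_graph S \<and> uverts S \<subseteq> uverts T \<and> uedges S \<subseteq> uedges T \<and> connected_graph S"


section \<open>Hypergraphs and matchings\<close>

record 'a hypergraph =
  hverts :: "'a set"
  hedges :: "'a set set"

definition is_hypergraph :: "'a hypergraph \<Rightarrow> bool" where
  "is_hypergraph H \<longleftrightarrow> (\<forall>a\<in>hedges H. a \<subseteq> hverts H)"

definition matching :: "'a hypergraph \<Rightarrow> 'a set set \<Rightarrow> bool" where
  "matching H M \<longleftrightarrow> M \<subseteq> hedges H \<and> pairwise disjnt M"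

definition perfect_matching :: "'a hypergraph \<Rightarrow> 'a set set \<Rightarrow> bool" where
  "perfect_matching H M \<longleftrightarrow> matching H M \<and> \<Union>M = hverts H"

text \<open>Only meaningful for hypergraphs with finitely many hyperedges, where the maximum exists.\<close>

definition matching_number :: "'a hypergraph \<Rightarrow> nat" where
  "matching_number H = Max (card ` {M. matching H M})"


section \<open>Tree-structured hypergraph systems\<close>

definition bag :: "'x set \<Rightarrow> ('x \<Rightarrow> 'v ugraph) \<Rightarrow> 'v \<Rightarrow> 'x set" where
  "bag U Q t = {x \<in> U. t \<in> uverts (Q x)}"

text \<open>
  The family \<open>A\<close> is indexed by the edges of \<open>T\<close>, its values elsewhere being irrelevant.
  Each edge \<open>{t, u}\<close> is considered with both orderings of its ends; the two resulting
  conditions coincide, since \<open>x\<close> and \<open>y\<close> can be interchanged.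
\<close>

definition tree_structured_system ::
  "'v ugraph \<Rightarrow> 'x set \<Rightarrow> ('x \<Rightarrow> 'v ugraph) \<Rightarrow> ('v set \<Rightarrow> 'x hypergraph) \<Rightarrow> bool" where
  "tree_structured_system T U Q A \<longleftrightarrow>
     (\<forall>t u. {t, u} \<in> uedges T \<longrightarrow>
        is_hypergraph (A {t, u}) \<and> hverts (A {t, u}) = U \<and>
        (\<forall>x. {x} \<in> hedges (A {t, u}) \<longleftrightarrow> x \<in> bag U Q t \<inter> bag U Q u) \<and>
        (\<forall>a\<in>hedges (A {t, u}). (\<nexists>x. a = {x}) \<longrightarrow>
           (\<exists>x y. x \<noteq> y \<and> a = {x, y} \<and> x \<in> bag U Q t \<and> y \<in> bag U Q u)))"

text \<open>
  \<open>S e\<close> is the set of hyperedges chosen for the edge \<open>e\<close>. Disjointness is required of the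
  choices labelled by their edge, so one hyperedge cannot serve two different edges.
\<close>

definition is_SDR ::
  "'v ugraph \<Rightarrow> ('v set \<Rightarrow> 'x hypergraph) \<Rightarrow> ('v set \<Rightarrow> nat) \<Rightarrow> ('v set \<Rightarrow> 'x set set) \<Rightarrow> bool" where
  "is_SDR T A q S \<longleftrightarrow>
     (\<forall>e\<in>uedges T. S e \<subseteq> hedges (A e) \<and> card (S e) = q e) \<and>
     pairwise (\<lambda>(e, a) (f, b). disjnt a b) (SIGMA e:uedges T. S e)"

datatype ('x, 'e) hvertex = Res 'x | New 'e nat

text \<open>\<open>Res x\<close> is the resource \<open>x\<close>, and \<open>New e i\<close> is the new vertex \<open>z\<^sub>e\<^sub>,\<^sub>i\<close>.\<close>

definition H_hypergraph ::
  "'v ugraph \<Rightarrow> 'x set \<Rightarrow> ('v set \<Rightarrow> 'x hypergraph) \<Rightarrow> ('v set \<Rightarrow> nat)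
     \<Rightarrow> ('x, 'v set) hvertex hypergraph" where
  "H_hypergraph T U A q =
     \<lparr> hverts = Res ` U \<union> {New e i | e i. e \<in> uedges T \<and> i \<in> {1..q e}},
       hedges = {{Res x} | x. x \<in> U} \<union>
                {{New e i} \<union> Res ` a | e i a.
                   e \<in> uedges T \<and> i \<in> {1..q e} \<and> a \<in> hedges (A e)} \<rparr>"

definition union_hypergraph ::
  "'x set \<Rightarrow> ('e \<Rightarrow> 'x hypergraph) \<Rightarrow> 'e set \<Rightarrow> 'x hypergraph" where
  "union_hypergraph U A F = \<lparr> hverts = U, hedges = (\<Union>e\<in>F. hedges (A e)) \<rparr>"

end

theory Submission
  imports Defs "HOL-Library.Transitive_Closure_Table"
begin

text \<open>
  SDRs and perfect matchings of \<open>H_hypergraph T U A q\<close> are translations of each other: the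
  hyperedge that covers the new vertex \<open>New e i\<close> is the \<open>i\<close>-th choice for \<open>e\<close>, and the loops
  \<open>{Res x}\<close> absorb the unused resources. An SDR also yields large matchings at once. The content
  is that the Hall condition suffices.

  Call \<open>X\<close> a cover of a set \<open>F\<close> of tree edges if it meets every hyperedge of every \<open>A e\<close> with
  \<open>e \<in> F\<close>. A matching is at most as large as a cover, so the Hall condition makes every cover of
  \<open>F\<close> have at least \<open>sum q F\<close> elements, and this consequence already gives an SDR, by induction
  on the number of edges. Let \<open>e = {t, l}\<close> be an edge having no other demanded edge on its side
  of \<open>l\<close>. The resources in the bag of \<open>l\<close> but not in that of \<open>t\<close> are of no use to the other
  edges. So one needs \<open>q e\<close> hyperedges of \<open>A e\<close> whose traces in the bag of \<open>t\<close> form a set \<open>W\<close>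
  that the other edges can spare. By the induction hypothesis, they can spare \<open>W\<close> exactly when no
  cover \<open>X \<supseteq> W\<close> of a set \<open>F\<close> of them has surplus \<open>card X - sum q F\<close> below \<open>card W\<close>. Write
  \<open>f S\<close> for the least surplus of a cover containing \<open>S\<close>.

  The key is that \<open>f\<close>, on the subsets of one bag, is the rank function of a matroid whose
  independent sets are the sets that can be spared. Submodularity comes from an uncrossing of two
  covers \<open>(F1, X1)\<close> and \<open>(F2, X2)\<close>: near \<open>t\<close> one takes union and intersection, and the two
  exchange their roles each time an edge of \<open>F1 \<inter> F2\<close> is passed, as in the usual uncrossing of
  vertex covers in bipartite graphs (\<open>uncross_covers\<close>). Rado's theorem (\<open>rado_deficiency\<close>) for \<open>f\<close> then either
  provides \<open>W\<close> together with its partners on the side of \<open>l\<close>, or a set of small rank; in the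
  second case a cover attaining that rank, enlarged by some resources in the bag of \<open>l\<close>, is a
  cover with too few elements.
\<close>

section \<open>Edge cuts of trees\<close>

text \<open>\<open>K\<close> is one side of a cut whose only edge is \<open>e\<close>.\<close>
definition isolates :: "'v ugraph \<Rightarrow> 'v set \<Rightarrow> 'v set \<Rightarrow> bool" where
  "isolates T K e \<longleftrightarrow> (\<forall>f\<in>uedges T. (f \<inter> K \<noteq> {} \<and> f - K \<noteq> {}) \<longleftrightarrow> f = e)"

lemma isolatesD: "isolates T K e \<Longrightarrow> f \<in> uedges T \<Longrightarrow> (f \<inter> K \<noteq> {} \<and> f - K \<noteq> {}) \<longleftrightarrow> f = e"
  by (simp add: isolates_def)

lemma isolates_Compl: "isolates T (- K) e \<longleftrightarrow> isolates T K e"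
  unfolding isolates_def by (simp add: Diff_eq conj_commute)

lemma edge_cases:
  assumes "simple_graph T" "e \<in> uedges T"
  obtains t u where "e = {t, u}" "t \<noteq> u" "t \<in> uverts T" "u \<in> uverts T"
proof -
  have "e \<subseteq> uverts T" "card e = 2"
    using assms by (auto simp: simple_graph_def)
  then show thesis
    using that by (auto simp: card_2_iff)
qed

lemma rtrancl_path_walk:
  assumes "rtrancl_path r x xs y" "x \<in> uverts T"
    and "\<And>a b. r a b \<Longrightarrow> {a, b} \<in> uedges T"
    and "\<And>e. e \<in> uedges T \<Longrightarrow> e \<subseteq> uverts T"
  shows "walk T (x # xs) \<and> last (x # xs) = y"
  using assms(1,2)
proof induction
  case (base x)
  then show ?case by (simp add: walk_def)
next
  case (step x y ys z)
  have xy: "{x, y} \<in> uedges T" "y \<in> uverts T"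
    using assms(3,4) step.hyps(1) by blast+
  then show ?case
    using step.IH step.prems by (auto simp: walk_def)
qed

text \<open>
  Take for \<open>K\<close> the component of one end of \<open>e\<close> after deletion of \<open>e\<close>. If it contained the
  other end, a path between the ends avoiding \<open>e\<close> would close up with \<open>e\<close> to a cycle.
\<close>
lemma tree_edge_isolated:
  assumes T: "finite_tree T" and e: "e \<in> uedges T"
  shows "\<exists>K. isolates T K e"
proof -
  have sg: "simple_graph T" and acyc: "\<nexists>p. graph_cycle T p"
    using T by (auto simp: finite_tree_def)
  have verts: "\<And>f. f \<in> uedges T \<Longrightarrow> f \<subseteq> uverts T"
    using sg by (auto simp: simple_graph_def)
  obtain t u where tu: "e = {t, u}" "t \<noteq> u" "t \<in> uverts T"
    using edge_cases[OF sg e] by metis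
  define r where "r a b \<longleftrightarrow> {a, b} \<in> uedges T - {e}" for a b
  define K where "K = {w. r\<^sup>*\<^sup>* t w}"
  have uK: "u \<notin> K"
  proof
    assume "u \<in> K"
    then obtain xs0 where "rtrancl_path r t xs0 u"
      by (auto simp: K_def rtranclp_eq_rtrancl_path)
    then obtain xs where xs: "rtrancl_path r t xs u" "distinct (t # xs)"
      by (rule rtrancl_path_distinct)
    have w: "walk T (t # xs)" "last (t # xs) = u"
      using rtrancl_path_walk[OF xs(1) tu(3)] verts by (auto simp: r_def)
    have "length xs \<ge> 2"
    proof (rule ccontr)
      assume "\<not> length xs \<ge> 2"
      then consider "xs = []" | y where "xs = [y]"
        by (cases xs; cases "tl xs") auto
      then show False
      proof cases
        case 1
        then show ?thesis using w(2) tu(2) by simp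
      next
        case 2
        then have "r t u"
          using xs(1) w(2) by (auto elim: rtrancl_path.cases)
        then show ?thesis by (simp add: r_def tu(1))
      qed
    qed
    then have "graph_cycle T (t # xs)"
      using w xs(2) e tu(1) by (simp add: graph_cycle_def insert_commute del: last.simps)
    then show False using acyc by blast
  qed
  have "(f \<inter> K \<noteq> {} \<and> f - K \<noteq> {}) \<longleftrightarrow> f = e" if f: "f \<in> uedges T" for f
  proof
    assume "f = e"
    moreover have "t \<in> K" by (simp add: K_def)
    ultimately show "f \<inter> K \<noteq> {} \<and> f - K \<noteq> {}" using uK tu(1) by auto
  next
    assume cr: "f \<inter> K \<noteq> {} \<and> f - K \<noteq> {}"
    show "f = e"
    proof (rule ccontr)
      assume "f \<noteq> e"
      obtain a b where ab: "f = {a, b}" "a \<in> K" "b \<notin> K"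
      proof (rule edge_cases[OF sg f])
        fix p q assume "f = {p, q}"
        then show thesis using cr that[of p q] that[of q p] by (auto simp: insert_commute)
      qed
      then have "r a b" using f \<open>f \<noteq> e\<close> by (simp add: r_def)
      with ab(2) have "b \<in> K" by (auto simp: K_def intro: rtranclp.rtrancl_into_rtrancl)
      then show False using ab(3) by simp
    qed
  qed
  then have "isolates T K e" unfolding isolates_def by blast
  then show ?thesis ..
qed

text \<open>
  Every edge separates the tree, so the parity of the number of edges of \<open>G\<close> that separate
  \<open>v\<close> from a fixed vertex is a colour of \<open>v\<close> which changes exactly along the edges of \<open>G\<close>.
\<close>
lemma tree_parity_colouring:
  assumes T: "finite_tree T" and G: "G \<subseteq> uedges T"
  obtains c :: "'v \<Rightarrow> bool" where "c (t::'v)"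
    and "\<And>u v. {u, v} \<in> uedges T \<Longrightarrow> (c u \<noteq> c v) \<longleftrightarrow> {u, v} \<in> G"
proof -
  have "finite (uedges T)"
    using T by (auto simp: finite_tree_def simple_graph_def intro: finite_subset[of _ "Pow (uverts T)"])
  then have finG: "finite G" using G finite_subset by blast
  define K where "K e = (SOME K. isolates T K e)" for e
  have K: "isolates T (K e) e" if "e \<in> uedges T" for e
    unfolding K_def by (rule someI_ex) (rule tree_edge_isolated[OF T that])
  define c where "c v \<longleftrightarrow> even (card {e \<in> G. v \<in> K e})" for v
  have c: "(c u \<noteq> c v) \<longleftrightarrow> d \<in> G" if d: "d = {u, v}" "d \<in> uedges T" for u v d
  proof -
    have cross: "(u \<in> K e) \<noteq> (v \<in> K e) \<longleftrightarrow> e = d" if "e \<in> G" for e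
    proof -
      have "(d \<inter> K e \<noteq> {} \<and> d - K e \<noteq> {}) \<longleftrightarrow> d = e"
        by (rule isolatesD[OF K d(2)]) (use that G in blast)
      moreover have "(d \<inter> K e \<noteq> {} \<and> d - K e \<noteq> {}) \<longleftrightarrow> (u \<in> K e) \<noteq> (v \<in> K e)"
        unfolding d(1) by auto
      ultimately show ?thesis by metis
    qed
    define R where "R = {e \<in> G - {d}. u \<in> K e}"
    have R: "R = {e \<in> G - {d}. v \<in> K e}"
      unfolding R_def using cross by blast
    have finR: "finite R" "d \<notin> R" using finG by (simp_all add: R_def)
    show ?thesis
    proof (cases "d \<in> G")
      case False
      then have "{e \<in> G. u \<in> K e} = {e \<in> G. v \<in> K e}" using cross by blast
      then show ?thesis using False by (simp add: c_def)
    next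
      case True
      have "{e \<in> G. u \<in> K e} = (if u \<in> K d then insert d R else R)"
        using True by (auto simp: R_def)
      moreover have "{e \<in> G. v \<in> K e} = (if v \<in> K d then insert d R else R)"
        using True by (auto simp: R)
      ultimately have "c u \<longleftrightarrow> (even (card R) \<longleftrightarrow> u \<notin> K d)" "c v \<longleftrightarrow> (even (card R) \<longleftrightarrow> v \<notin> K d)"
        using finR by (simp_all add: c_def)
      then show ?thesis using cross[OF True] True by blast
    qed
  qed
  show thesis
  proof (rule that[of "\<lambda>v. c v = c t"])
    show "c t = c t" ..
    show "((c u = c t) \<noteq> (c v = c t)) \<longleftrightarrow> {u, v} \<in> G" if "{u, v} \<in> uedges T" for u v
      using c[OF refl that] by blast
  qed
qed

lemma successively_crossing:
  assumes "successively R p" "p \<noteq> []" "P (hd p)" "\<not> P (last p)"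
  shows "\<exists>a\<in>set p. \<exists>b\<in>set p. R a b \<and> P a \<and> \<not> P b"
  using assms
proof (induction p)
  case (Cons a p)
  show ?case
  proof (cases "p = []")
    case False
    then have "R a (hd p)" "successively R p" "\<not> P (last p)" "P a" "hd p \<in> set p"
      using Cons.prems by (auto simp: successively_Cons)
    then show ?thesis using Cons.IH False by (cases "P (hd p)") (auto intro!: bexI)
  qed (use Cons.prems in auto)
qed simp

lemma connected_crossing_edge:
  assumes "connected_graph S" "a \<in> uverts S" "b \<in> uverts S" "P a" "\<not> P b"
  obtains u v where "{u, v} \<in> uedges S" "P u" "\<not> P v"
proof -
  obtain p where "walk S p" "hd p = a" "last p = b"
    using assms by (auto simp: connected_graph_def)
  then show thesis
    using successively_crossing[of "\<lambda>u v. {u, v} \<in> uedges S" p P] assms(4,5) that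
    by (auto simp: walk_def)
qed

section \<open>Independent partial transversals\<close>

text \<open>
  These are the axioms of a matroid rank function. The values are integers because the rank
  function to which this is applied is a minimum of differences.
\<close>
locale rank_function =
  fixes P :: "'a set" and f :: "'a set \<Rightarrow> int"
  assumes finite_ground: "finite P"
    and rank_empty: "f {} = 0"
    and rank_mono: "A \<subseteq> B \<Longrightarrow> B \<subseteq> P \<Longrightarrow> f A \<le> f B"
    and rank_insert: "x \<in> P \<Longrightarrow> A \<subseteq> P \<Longrightarrow> f (insert x A) \<le> f A + 1"
    and rank_submodular: "A \<subseteq> P \<Longrightarrow> B \<subseteq> P \<Longrightarrow> f (A \<union> B) + f (A \<inter> B) \<le> f A + f B"
begin

lemma rank_Un_le:
  assumes "A \<subseteq> P" "B \<subseteq> P"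
  shows "f (A \<union> B) \<le> f A + int (card B)"
proof -
  have "finite B" using assms(2) finite_ground finite_subset by blast
  then show ?thesis using assms(2)
  proof induction
    case (insert x B)
    then have "f (insert x (A \<union> B)) \<le> f (A \<union> B) + 1"
      using assms(1) by (intro rank_insert) auto
    then show ?case using insert by simp
  qed simp
qed

lemma rank_le_card: "B \<subseteq> P \<Longrightarrow> f B \<le> int (card B)"
  using rank_Un_le[of "{}" B] rank_empty by simp

lemma ex_basis:
  assumes "S \<subseteq> P"
  shows "\<exists>W\<subseteq>S. f W = int (card W) \<and> f W = f S"
proof -
  have "finite S" using assms finite_ground finite_subset by blast
  then show ?thesis using assms
  proof induction
    case empty
    then show ?case using rank_empty by auto
  next
    case (insert x S)
    then obtain W where W: "W \<subseteq> S" "f W = int (card W)" "f W = f S" by auto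
    have le: "f (insert x W) \<le> f W + 1" "f (insert x S) \<le> f S + 1"
      using insert.prems W(1) by (auto intro!: rank_insert)
    have ge: "f W \<le> f (insert x W)" "f S \<le> f (insert x S)" "f (insert x W) \<le> f (insert x S)"
      using insert.prems W(1) by (auto intro!: rank_mono)
    have "f (insert x W \<union> S) + f (insert x W \<inter> S) \<le> f (insert x W) + f S"
      using insert.prems W(1) by (intro rank_submodular) auto
    moreover have "insert x W \<union> S = insert x S" "insert x W \<inter> S = W"
      using W(1) insert.hyps by auto
    ultimately have sub: "f (insert x S) \<le> f (insert x W)" using W(3) by simp
    show ?case
    proof (cases "f (insert x W) = f W")
      case True
      then show ?thesis using W sub ge by (intro exI[of _ W]) auto
    next
      case False
      moreover have "card (insert x W) = Suc (card W)"
        using W(1) insert.hyps by (intro card_insert_disjoint) (auto intro: finite_subset)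
      ultimately show ?thesis
        using W le ge sub by (intro exI[of _ "insert x W"]) auto
    qed
  qed
qed

lemma ex_independent_subset:
  assumes "S \<subseteq> P" "int k \<le> f S"
  shows "\<exists>W\<subseteq>S. card W = k \<and> f W = int k"
proof -
  obtain B where B: "B \<subseteq> S" "f B = int (card B)" "f B = f S"
    using ex_basis[OF assms(1)] by blast
  then have "k \<le> card B" using assms(2) by simp
  then obtain W where W: "W \<subseteq> B" "card W = k" using obtain_subset_with_card_n by metis
  have "f (W \<union> (B - W)) \<le> f W + int (card (B - W))"
    using W B assms(1) by (intro rank_Un_le) auto
  moreover have "W \<union> (B - W) = B" using W by auto
  moreover have "card B = k + card (B - W)"
    using W \<open>k \<le> card B\<close> B(1) assms(1) finite_ground
    by (metis card_Diff_subset finite_subset le_add_diff_inverse)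
  ultimately have "int k \<le> f W" using B(2) by simp
  then show ?thesis using rank_le_card[of W] W B assms(1) by (intro exI[of _ W]) auto
qed

text \<open>
  Rado's theorem in its deficiency form. As long as some \<open>A i\<close> has two elements, one of them
  can be deleted without violating the hypothesis: if both deletions were blocked, at
  \<open>insert i J1\<close> and at \<open>insert i J2\<close>, then by submodularity the hypothesis would fail at
  \<open>insert i (J1 \<union> J2)\<close> or at \<open>J1 \<inter> J2\<close>. Once every \<open>A i\<close>
  has at most one element, their union has rank at least \<open>k\<close> and contains the transversal.
\<close>
theorem rado_deficiency:
  fixes A :: "'i \<Rightarrow> 'a set" and k :: nat
  assumes "finite I" "\<And>i. i \<in> I \<Longrightarrow> A i \<subseteq> P"
    and "\<And>J. J \<subseteq> I \<Longrightarrow> int k + int (card J) \<le> f (\<Union>(A ` J)) + int (card I)"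
  shows "\<exists>I'\<subseteq>I. \<exists>g. card I' = k \<and> inj_on g I' \<and> (\<forall>i\<in>I'. g i \<in> A i) \<and> f (g ` I') = int k"
  using assms(2,3)
proof (induction "\<Sum>i\<in>I. card (A i)" arbitrary: A rule: less_induct)
  case less
  note sub = less.prems(1) and defi = less.prems(2)
  have finA: "finite (A i)" if "i \<in> I" for i
    using sub[OF that] finite_ground finite_subset by blast
  show ?case
  proof (cases "\<exists>i\<in>I. \<exists>x\<in>A i. \<exists>y\<in>A i. x \<noteq> y")
    case True
    then obtain i x y where i: "i \<in> I" "x \<in> A i" "y \<in> A i" "x \<noteq> y" by blast
    define D where "D z = A(i := A i - {z})" for z
    define ok where
      "ok z \<longleftrightarrow> (\<forall>J\<subseteq>I. int k + int (card J) \<le> f (\<Union>(D z ` J)) + int (card I))" for z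
    have blocked: "\<exists>J\<subseteq>I - {i}. f (\<Union>(A ` J) \<union> (A i - {z})) + int (card I) \<le> int k + int (card J)"
      if nok: "\<not> ok z" for z
    proof -
      obtain J where J: "J \<subseteq> I" "f (\<Union>(D z ` J)) + int (card I) < int k + int (card J)"
        using nok by (auto simp: ok_def not_le)
      have "i \<in> J"
      proof (rule ccontr)
        assume "i \<notin> J"
        then have "D z ` J = A ` J" by (auto simp: D_def)
        then show False using defi[OF J(1)] J(2) by simp
      qed
      moreover have "\<Union>(D z ` J) = \<Union>(A ` (J - {i})) \<union> (A i - {z})"
        using \<open>i \<in> J\<close> by (auto simp: D_def split: if_splits)
      moreover have "card J = Suc (card (J - {i}))"
        using \<open>i \<in> J\<close> J(1) assms(1) by (metis card_Suc_Diff1 finite_subset)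
      ultimately show ?thesis
        using J by (intro exI[of _ "J - {i}"]) auto
    qed
    have "ok x \<or> ok y"
    proof (rule ccontr)
      assume "\<not> (ok x \<or> ok y)"
      then have nok: "\<not> ok x" "\<not> ok y" by auto
      obtain J1 where
        J1: "J1 \<subseteq> I - {i}" "f (\<Union>(A ` J1) \<union> (A i - {x})) + int (card I) \<le> int k + int (card J1)"
        using blocked[OF nok(1)] by (elim exE conjE)
      obtain J2 where
        J2: "J2 \<subseteq> I - {i}" "f (\<Union>(A ` J2) \<union> (A i - {y})) + int (card I) \<le> int k + int (card J2)"
        using blocked[OF nok(2)] by (elim exE conjE)
      define B1 where "B1 = \<Union>(A ` J1) \<union> (A i - {x})"
      define B2 where "B2 = \<Union>(A ` J2) \<union> (A i - {y})"
      have "\<Union>(A ` J) \<subseteq> P" if "J \<subseteq> I - {i}" for J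
        using that sub by blast
      then have B: "B1 \<subseteq> P" "B2 \<subseteq> P"
        using J1(1) J2(1) sub[OF i(1)] unfolding B1_def B2_def by blast+
      have "B1 \<union> B2 = \<Union>(A ` insert i (J1 \<union> J2))" using i(4) by (auto simp: B1_def B2_def)
      moreover have "insert i (J1 \<union> J2) \<subseteq> I" "J1 \<inter> J2 \<subseteq> I" using J1(1) J2(1) i(1) by blast+
      ultimately have u: "int k + int (card (insert i (J1 \<union> J2))) \<le> f (B1 \<union> B2) + int (card I)"
        and n0: "int k + int (card (J1 \<inter> J2)) \<le> f (\<Union>(A ` (J1 \<inter> J2))) + int (card I)"
        using defi by metis+
      have "f (\<Union>(A ` (J1 \<inter> J2))) \<le> f (B1 \<inter> B2)"
      proof (rule rank_mono)
        show "\<Union>(A ` (J1 \<inter> J2)) \<subseteq> B1 \<inter> B2" unfolding B1_def B2_def by blast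
        show "B1 \<inter> B2 \<subseteq> P" using B by blast
      qed
      then have n: "int k + int (card (J1 \<inter> J2)) \<le> f (B1 \<inter> B2) + int (card I)"
        using n0 by linarith
      have fin: "finite J1" "finite J2" using J1(1) J2(1) assms(1) finite_subset by blast+
      have "card (insert i (J1 \<union> J2)) = Suc (card (J1 \<union> J2))"
        using fin J1(1) J2(1) by (subst card_insert_disjoint) auto
      then show False
        using u n rank_submodular[OF B] J1(2) J2(2) card_Un_Int[OF fin]
        unfolding B1_def[symmetric] B2_def[symmetric] by linarith
    qed
    then obtain z where z: "z \<in> A i" "ok z" using i by blast
    have "(\<Sum>j\<in>I. card (D z j)) < (\<Sum>j\<in>I. card (A j))"
    proof (rule sum_strict_mono_ex1[OF assms(1)])
      show "\<forall>j\<in>I. card (D z j) \<le> card (A j)"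
        using finA by (auto simp: D_def intro: card_mono)
      have "card (D z i) < card (A i)"
        using finA[OF i(1)] z(1) by (simp add: D_def card_Diff1_less del: card_Diff_insert card_Diff_singleton)
      then show "\<exists>j\<in>I. card (D z j) < card (A j)" using i(1) by blast
    qed
    moreover have "D z j \<subseteq> P" if "j \<in> I" for j using sub that by (auto simp: D_def)
    ultimately obtain I' g where "I' \<subseteq> I" "card I' = k" "inj_on g I'" "\<forall>j\<in>I'. g j \<in> D z j"
      "f (g ` I') = int k"
      using less.hyps[of "D z"] z(2) unfolding ok_def by blast
    moreover have "D z j \<subseteq> A j" for j by (auto simp: D_def)
    ultimately show ?thesis by blast
  next
    case False
    have AI: "\<Union>(A ` I) \<subseteq> P" "int k \<le> f (\<Union>(A ` I))" using sub defi[of I] by auto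
    obtain W where W: "W \<subseteq> \<Union>(A ` I)" "card W = k" "f W = int k"
      using ex_independent_subset[OF AI] by (elim exE conjE)
    have "\<forall>w\<in>W. \<exists>i\<in>I. w \<in> A i" using W(1) by auto
    then obtain h where h: "\<And>w. w \<in> W \<Longrightarrow> h w \<in> I \<and> w \<in> A (h w)" by metis
    \<comment> \<open>Elements assigned to the same index lie in the same set, which is now a singleton.\<close>
    have inj: "inj_on h W"
      using h False by (metis inj_onI)
    show ?thesis
    proof (intro exI[of _ "h ` W"] exI[of _ "the_inv_into W h"] conjI)
      show "h ` W \<subseteq> I" using h by auto
      show "card (h ` W) = k" using W(2) inj by (simp add: card_image)
      show "inj_on (the_inv_into W h) (h ` W)" using inj by (rule inj_on_the_inv_into)
      show "\<forall>i\<in>h ` W. the_inv_into W h i \<in> A i"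
        using h inj by (auto simp: the_inv_into_f_f)
      have "the_inv_into W h ` h ` W = W" using inj by (force simp: the_inv_into_f_f)
      then show "f (the_inv_into W h ` h ` W) = int k" using W(3) by simp
    qed
  qed
qed

end

section \<open>Covers of tree-structured systems\<close>

text \<open>
  \<open>V\<close> is the set of resources that are still available: as the induction uses up resources, only
  the hyperedges contained in \<open>V\<close> remain to be covered.
\<close>
definition covers :: "('e \<Rightarrow> 'x hypergraph) \<Rightarrow> 'x set \<Rightarrow> 'e set \<Rightarrow> 'x set \<Rightarrow> bool" where
  "covers A V F X \<longleftrightarrow> X \<subseteq> V \<and> (\<forall>e\<in>F. \<forall>a\<in>hedges (A e). a \<subseteq> V \<longrightarrow> a \<inter> X \<noteq> {})"

locale tree_system =
  fixes T :: "'v ugraph" and U :: "'x set" and Q :: "'x \<Rightarrow> 'v ugraph"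
    and A :: "'v set \<Rightarrow> 'x hypergraph"
  assumes tree: "finite_tree T"
    and finite_resources: "finite U"
    and subtree: "x \<in> U \<Longrightarrow> is_subtree (Q x) T"
    and system: "tree_structured_system T U Q A"
begin

lemma simple: "simple_graph T"
  using tree by (simp add: finite_tree_def)

lemma finite_edges: "finite (uedges T)"
  using tree by (auto simp: finite_tree_def simple_graph_def intro: finite_subset[of _ "Pow (uverts T)"])

lemma loop_iff:
  assumes "{t, u} \<in> uedges T"
  shows "{x} \<in> hedges (A {t, u}) \<longleftrightarrow> x \<in> U \<and> {t, u} \<subseteq> uverts (Q x)"
proof -
  have "{x} \<in> hedges (A {t, u}) \<longleftrightarrow> x \<in> bag U Q t \<inter> bag U Q u"
    using system assms unfolding tree_structured_system_def by blast
  then show ?thesis by (auto simp: bag_def)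
qed

lemma hyperedge_cases:
  assumes e: "{t, u} \<in> uedges T" and a: "a \<in> hedges (A {t, u})"
  obtains (loop) x where "a = {x}" "x \<in> U" "t \<in> uverts (Q x)" "u \<in> uverts (Q x)"
    | (pair) x y where "a = {x, y}" "x \<noteq> y" "x \<in> U" "y \<in> U" "t \<in> uverts (Q x)" "u \<in> uverts (Q y)"
proof (cases "\<exists>x. a = {x}")
  case True
  then show thesis using loop loop_iff[OF e] a by auto
next
  case False
  have "\<forall>a\<in>hedges (A {t, u}). (\<nexists>x. a = {x}) \<longrightarrow>
           (\<exists>x y. x \<noteq> y \<and> a = {x, y} \<and> x \<in> bag U Q t \<and> y \<in> bag U Q u)"
    using system e unfolding tree_structured_system_def by blast
  then obtain x y where "x \<noteq> y" "a = {x, y}" "x \<in> bag U Q t" "y \<in> bag U Q u"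
    using a False by blast
  then show thesis using pair by (auto simp: bag_def)
qed

lemma hyperedge_facts:
  assumes e: "e \<in> uedges T" and a: "a \<in> hedges (A e)"
  shows "a \<noteq> {}" "a \<subseteq> U" "\<And>x. x \<in> a \<Longrightarrow> e \<inter> uverts (Q x) \<noteq> {}"
proof -
  obtain t u where tu: "e = {t, u}" using edge_cases[OF simple e] by metis
  have "a \<noteq> {} \<and> a \<subseteq> U \<and> (\<forall>x\<in>a. e \<inter> uverts (Q x) \<noteq> {})"
    using e a unfolding tu by (rule hyperedge_cases) auto
  then show "a \<noteq> {}" "a \<subseteq> U" "\<And>x. x \<in> a \<Longrightarrow> e \<inter> uverts (Q x) \<noteq> {}" by auto
qed

lemma support_edge:
  assumes "x \<in> U" "e \<in> uedges (Q x)"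
  shows "e \<in> uedges T" "e \<subseteq> uverts (Q x)"
  using subtree[OF assms(1)] assms(2) by (auto simp: is_subtree_def simple_graph_def)

text \<open>A connected support can pass from one side of an edge to the other only along that edge.\<close>
lemma support_crosses:
  assumes x: "x \<in> U" and K: "isolates T K e"
    and ab: "a \<in> uverts (Q x)" "b \<in> uverts (Q x)" "a \<in> K" "b \<notin> K"
  shows "e \<subseteq> uverts (Q x)"
proof -
  have "connected_graph (Q x)" using subtree[OF x] by (simp add: is_subtree_def)
  then obtain u v where uv: "{u, v} \<in> uedges (Q x)" "u \<in> K" "v \<notin> K"
    using ab by (rule connected_crossing_edge)
  then have "{u, v} = e"
    using isolatesD[OF K support_edge(1)[OF x uv(1)]] by blast
  then show ?thesis using support_edge[OF x uv(1)] by simp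
qed

text \<open>
  Two covers can be uncrossed relative to a vertex \<open>t\<close>. Colour the vertices of \<open>T\<close> by the parity
  of the number of edges of \<open>F1 \<inter> F2\<close> between them and \<open>t\<close>. A resource in exactly one of
  \<open>X1\<close>, \<open>X2\<close> is no loop of an edge of \<open>F1 \<inter> F2\<close>, so its support has one colour; it goes to \<open>X3\<close>
  if that colour is the colour of \<open>t\<close> and to \<open>X4\<close> otherwise, and edges in exactly one of
  \<open>F1\<close>, \<open>F2\<close> are distributed in the same way. At an edge of \<open>F1 \<inter> F2\<close> the two ends of a pair
  have different colours, so a pair with one end in \<open>X1\<close> and the other in \<open>X2\<close> contributes one
  resource to each of \<open>X3\<close>, \<open>X4\<close>.
\<close>
lemma uncross_covers:
  assumes V: "V \<subseteq> U" and F: "F1 \<subseteq> uedges T" "F2 \<subseteq> uedges T"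
    and X1: "covers A V F1 X1" and X2: "covers A V F2 X2"
  obtains F3 F4 X3 X4 where "covers A V F3 X3" "covers A V F4 X4"
    "F3 \<union> F4 = F1 \<union> F2" "F3 \<inter> F4 = F1 \<inter> F2" "X3 \<union> X4 = X1 \<union> X2" "X3 \<inter> X4 = X1 \<inter> X2"
    "\<And>x. x \<in> X1 \<union> X2 \<Longrightarrow> t \<in> uverts (Q x) \<Longrightarrow> x \<in> X3"
proof -
  define G where "G = F1 \<inter> F2"
  have "G \<subseteq> uedges T" using F by (auto simp: G_def)
  then obtain c where ct: "c t"
    and c: "\<And>u v. {u, v} \<in> uedges T \<Longrightarrow> (c u \<noteq> c v) \<longleftrightarrow> {u, v} \<in> G"
    by (rule tree_parity_colouring[OF tree, where t = t]) blast
  define XG where "XG = X1 \<inter> X2"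
  define X3 where "X3 = XG \<union> {x \<in> X1 \<union> X2. \<forall>v\<in>uverts (Q x). c v}"
  define X4 where "X4 = XG \<union> {x \<in> X1 \<union> X2. \<exists>v\<in>uverts (Q x). \<not> c v}"
  define F3 where "F3 = G \<union> {e \<in> F1 \<union> F2. \<forall>v\<in>e. c v}"
  define F4 where "F4 = G \<union> {e \<in> F1 \<union> F2. \<exists>v\<in>e. \<not> c v}"
  have XV: "X1 \<subseteq> V" "X2 \<subseteq> V" using X1 X2 by (auto simp: covers_def)
  \<comment> \<open>An edge of \<open>G\<close> inside the support would make \<open>x\<close> a loop that both covers must contain.\<close>
  have mono: "c v = c w"
    if x: "x \<in> X1 \<union> X2" "x \<notin> XG" and vw: "v \<in> uverts (Q x)" "w \<in> uverts (Q x)" for x v w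
  proof -
    have xU: "x \<in> U" "x \<in> V" using x XV V by auto
    have False if pq: "p \<in> uverts (Q x)" "q \<in> uverts (Q x)" "c p" "\<not> c q" for p q
    proof -
      have "connected_graph (Q x)" using subtree[OF xU(1)] by (simp add: is_subtree_def)
      then obtain a b where ab: "{a, b} \<in> uedges (Q x)" "c a" "\<not> c b"
        using pq by (rule connected_crossing_edge)
      note abT = support_edge[OF xU(1) ab(1)]
      have "{a, b} \<in> G" using c[OF abT(1)] ab by blast
      moreover have "{x} \<in> hedges (A {a, b})" using loop_iff[OF abT(1)] abT(2) xU(1) by simp
      ultimately have "x \<in> X1" "x \<in> X2"
        using X1 X2 xU(2) by (fastforce simp: covers_def G_def)+
      then show False using x(2) by (simp add: XG_def)
    qed
    then show ?thesis using vw by blast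
  qed
  have goes: "x \<in> (if c v then X3 else X4)" if x: "x \<in> X1 \<union> X2" and v: "v \<in> uverts (Q x)" for x v
  proof (cases "x \<in> XG")
    case True
    then show ?thesis by (simp add: X3_def X4_def)
  next
    case False
    then have eq: "c w = c v" if "w \<in> uverts (Q x)" for w
      using mono[OF x _ that v] by blast
    show ?thesis
    proof (cases "c v")
      case True
      then have "x \<in> X3" using x eq unfolding X3_def by blast
      then show ?thesis using True by simp
    next
      case False
      then have "x \<in> X4" using x v unfolding X4_def by blast
      then show ?thesis using False by simp
    qed
  qed
  have hit_G: "a \<inter> X3 \<noteq> {} \<and> a \<inter> X4 \<noteq> {}" if e: "e \<in> G" and a: "a \<in> hedges (A e)" "a \<subseteq> V" for e a
  proof -
    have eT: "e \<in> uedges T" using e F by (auto simp: G_def)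
    have "e \<in> F1" "e \<in> F2" using e by (auto simp: G_def)
    then have h1: "a \<inter> X1 \<noteq> {}" and h2: "a \<inter> X2 \<noteq> {}"
      using X1 X2 a unfolding covers_def by blast+
    obtain p l where pl: "e = {p, l}" by (rule edge_cases[OF simple eT])
    have cpl: "c p \<noteq> c l" using c[of p l] eT e pl by simp
    show ?thesis
    proof (cases "a \<inter> XG = {}")
      case False
      then show ?thesis by (auto simp: X3_def X4_def)
    next
      case no: True
      from eT a(1) show ?thesis unfolding pl
      proof (cases rule: hyperedge_cases)
        case (loop x)
        then show ?thesis using h1 h2 no by (auto simp: XG_def)
      next
        case (pair x y)
        then have "x \<in> X1 \<union> X2" "y \<in> X1 \<union> X2" using h1 h2 no by (auto simp: XG_def)
        then show ?thesis
          using goes[of x p] goes[of y l] pair cpl by (auto split: if_splits)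
      qed
    qed
  qed
  have hit: "a \<inter> (if c v then X3 else X4) \<noteq> {}"
    if e: "e \<in> F1 \<union> F2" "e \<notin> G" "v \<in> e" and a: "a \<in> hedges (A e)" "a \<subseteq> V" for e v a
  proof -
    have eT: "e \<in> uedges T" using e F by auto
    obtain x where x: "x \<in> a" "x \<in> X1 \<union> X2"
      using X1 X2 e a unfolding covers_def by blast
    obtain w where w: "w \<in> e" "w \<in> uverts (Q x)" using hyperedge_facts(3)[OF eT a(1) x(1)] by auto
    obtain p l where pl: "e = {p, l}" by (rule edge_cases[OF simple eT])
    have "c v = c w" using c[of p l] eT e w(1) pl by auto
    then show ?thesis using goes[OF x(2) w(2)] x(1) by auto
  qed
  show thesis
  proof (rule that[of F3 X3 F4 X4])
    have "a \<inter> X3 \<noteq> {}" if e: "e \<in> F3" and a: "a \<in> hedges (A e)" "a \<subseteq> V" for e a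
    proof (cases "e \<in> G")
      case False
      then have e': "e \<in> F1 \<union> F2" "\<forall>v\<in>e. c v" using e by (auto simp: F3_def)
      then have "e \<in> uedges T" using F by auto
      then obtain v where "v \<in> e" using edge_cases[OF simple] by blast
      then show ?thesis using hit[OF e'(1) False _ a] e'(2) by metis
    qed (use hit_G a in blast)
    moreover have "X3 \<subseteq> V" using XV by (auto simp: X3_def XG_def)
    ultimately show "covers A V F3 X3" by (auto simp: covers_def)
    have "a \<inter> X4 \<noteq> {}" if e: "e \<in> F4" and a: "a \<in> hedges (A e)" "a \<subseteq> V" for e a
    proof (cases "e \<in> G")
      case False
      then obtain v where e': "e \<in> F1 \<union> F2" "v \<in> e" "\<not> c v" using e by (auto simp: F4_def)
      then show ?thesis using hit[OF e'(1) False e'(2) a] by simp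
    qed (use hit_G a in blast)
    moreover have "X4 \<subseteq> V" using XV by (auto simp: X4_def XG_def)
    ultimately show "covers A V F4 X4" by (auto simp: covers_def)
    show "F3 \<union> F4 = F1 \<union> F2" "F3 \<inter> F4 = F1 \<inter> F2" by (auto simp: F3_def F4_def G_def)
    show "X3 \<union> X4 = X1 \<union> X2" "X3 \<inter> X4 = X1 \<inter> X2" by (auto simp: X3_def X4_def XG_def)
    show "x \<in> X3" if "x \<in> X1 \<union> X2" "t \<in> uverts (Q x)" for x
      using goes[OF that] ct by simp
  qed
qed

text \<open>
  This measures what the edges of \<open>E\<close> can spare: if \<open>W\<close> is withheld from them, then a cover \<open>X\<close>
  of \<open>F\<close> among the remaining resources gives the cover \<open>X \<union> W\<close>, so the lower bound
  \<open>sum q F \<le> card X\<close> survives when the surplus of \<open>W\<close> is at least \<open>card W\<close>.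
\<close>
definition surplus :: "('v set \<Rightarrow> nat) \<Rightarrow> 'v set set \<Rightarrow> 'x set \<Rightarrow> 'x set \<Rightarrow> int" where
  "surplus q E V S =
     Min {int (card X) - int (sum q F) | F X. F \<subseteq> E \<and> covers A V F X \<and> S \<subseteq> X}"

context
  fixes q :: "'v set \<Rightarrow> nat" and E :: "'v set set" and V :: "'x set"
  assumes E: "E \<subseteq> uedges T" and V: "V \<subseteq> U"
begin

lemma finV: "finite V"
  using V finite_resources finite_subset by blast

lemma finE: "finite E"
  using E finite_edges finite_subset by blast

lemma finite_surpluses:
  "finite {int (card X) - int (sum q F) | F X. F \<subseteq> E \<and> covers A V F X \<and> S \<subseteq> X}"
proof -
  have "{int (card X) - int (sum q F) | F X. F \<subseteq> E \<and> covers A V F X \<and> S \<subseteq> X}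
      \<subseteq> (\<lambda>(F, X). int (card X) - int (sum q F)) ` (Pow E \<times> Pow V)"
    by (auto simp: covers_def)
  moreover have "finite (Pow E \<times> Pow V)" using finE finV by simp
  ultimately show ?thesis by (meson finite_imageI finite_subset)
qed

lemma surplus_le:
  "F \<subseteq> E \<Longrightarrow> covers A V F X \<Longrightarrow> S \<subseteq> X \<Longrightarrow> surplus q E V S \<le> int (card X) - int (sum q F)"
  unfolding surplus_def by (intro Min_le[OF finite_surpluses]) blast

lemma surplus_attained:
  assumes "S \<subseteq> V"
  obtains F X where "F \<subseteq> E" "covers A V F X" "S \<subseteq> X"
    "surplus q E V S = int (card X) - int (sum q F)"
proof -
  have "covers A V {} V" by (simp add: covers_def)
  then have "{int (card X) - int (sum q F) | F X. F \<subseteq> E \<and> covers A V F X \<and> S \<subseteq> X} \<noteq> {}"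
    using assms by blast
  from Min_in[OF finite_surpluses this] show thesis
    using that unfolding surplus_def by blast
qed

text \<open>
  Submodularity holds because optimal covers for \<open>S1\<close> and \<open>S2\<close> can be uncrossed relative to \<open>t\<close>:
  the sums of their sizes and of their demands are preserved, one of the new covers contains
  \<open>S1 \<union> S2\<close>, and the other one contains \<open>S1 \<inter> S2\<close>. Restriction to a single bag matters here, since
  elsewhere in the tree the two covers may have exchanged their roles.
\<close>
lemma surplus_rank_function:
  assumes hall: "\<And>F X. F \<subseteq> E \<Longrightarrow> covers A V F X \<Longrightarrow> sum q F \<le> card X"
    and P: "P \<subseteq> V" "\<And>x. x \<in> P \<Longrightarrow> t \<in> uverts (Q x)"
  shows "rank_function P (surplus q E V)"
proof
  show "finite P" using P(1) finV finite_subset by blast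
  obtain F X where "F \<subseteq> E" "covers A V F X" "surplus q E V {} = int (card X) - int (sum q F)"
    using surplus_attained[of "{}"] by auto
  then have "0 \<le> surplus q E V {}" using hall[of F X] by (simp del: of_nat_sum)
  moreover have "surplus q E V {} \<le> 0"
    using surplus_le[of "{}" "{}" "{}"] by (simp add: covers_def)
  ultimately show "surplus q E V {} = 0" by simp
next
  fix S S' assume S: "S \<subseteq> S'" "S' \<subseteq> P"
  have "S' \<subseteq> V" using S(2) P(1) by blast
  then obtain F X where "F \<subseteq> E" "covers A V F X" "S' \<subseteq> X"
      "surplus q E V S' = int (card X) - int (sum q F)"
    by (rule surplus_attained)
  then show "surplus q E V S \<le> surplus q E V S'"
    using surplus_le[of F X S] S(1) by auto
next
  fix x S assume x: "x \<in> P" "S \<subseteq> P"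
  have "S \<subseteq> V" using x(2) P(1) by blast
  then obtain F X where FX: "F \<subseteq> E" "covers A V F X" "S \<subseteq> X"
      "surplus q E V S = int (card X) - int (sum q F)"
    by (rule surplus_attained)
  have "covers A V F (insert x X)" using FX(2) x(1) P(1) by (auto simp: covers_def)
  then have "surplus q E V (insert x S) \<le> int (card (insert x X)) - int (sum q F)"
    using FX by (intro surplus_le) auto
  moreover have "card (insert x X) \<le> card X + 1"
    by (simp add: card_insert_le_m1 card_insert_if)
  ultimately show "surplus q E V (insert x S) \<le> surplus q E V S + 1" using FX(4) by linarith
next
  fix S1 S2 assume S: "S1 \<subseteq> P" "S2 \<subseteq> P"
  have S': "S1 \<subseteq> V" "S2 \<subseteq> V" using S P(1) by auto
  obtain F1 X1 where 1: "F1 \<subseteq> E" "covers A V F1 X1" "S1 \<subseteq> X1"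
      "surplus q E V S1 = int (card X1) - int (sum q F1)"
    using surplus_attained[OF S'(1)] .
  obtain F2 X2 where 2: "F2 \<subseteq> E" "covers A V F2 X2" "S2 \<subseteq> X2"
      "surplus q E V S2 = int (card X2) - int (sum q F2)"
    using surplus_attained[OF S'(2)] .
  have F12: "F1 \<subseteq> uedges T" "F2 \<subseteq> uedges T" using 1(1) 2(1) E by auto
  obtain F3 F4 X3 X4 where 3: "covers A V F3 X3" "covers A V F4 X4"
    "F3 \<union> F4 = F1 \<union> F2" "F3 \<inter> F4 = F1 \<inter> F2" "X3 \<union> X4 = X1 \<union> X2" "X3 \<inter> X4 = X1 \<inter> X2"
    "\<And>x. x \<in> X1 \<union> X2 \<Longrightarrow> t \<in> uverts (Q x) \<Longrightarrow> x \<in> X3"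
    by (rule uncross_covers[where t = t, OF V F12 1(2) 2(2)]) blast
  have "S1 \<union> S2 \<subseteq> X3" using 3(7) 1(3) 2(3) S P(2) by blast
  moreover have "F3 \<subseteq> E" using 3(3) 1(1) 2(1) by blast
  ultimately have u: "surplus q E V (S1 \<union> S2) \<le> int (card X3) - int (sum q F3)"
    using 3(1) by (intro surplus_le)
  have "S1 \<inter> S2 \<subseteq> X4" using 3(6) 1(3) 2(3) by blast
  moreover have "F4 \<subseteq> E" using 3(3) 1(1) 2(1) by blast
  ultimately have n: "surplus q E V (S1 \<inter> S2) \<le> int (card X4) - int (sum q F4)"
    using 3(2) by (intro surplus_le)
  have finX: "finite X1" "finite X2" "finite X3" "finite X4"
    using 1(2) 2(2) 3(1,2) finV by (auto simp: covers_def intro: finite_subset)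
  have finF: "finite F1" "finite F2" "finite F3" "finite F4"
    using 1(1) 2(1) \<open>F3 \<subseteq> E\<close> \<open>F4 \<subseteq> E\<close> finE by (auto intro: finite_subset)
  have "card X3 + card X4 = card X1 + card X2"
    using card_Un_Int[OF finX(1,2)] card_Un_Int[OF finX(3,4)] 3(5,6) by simp
  moreover have "sum q F3 + sum q F4 = sum q F1 + sum q F2"
    using sum.union_inter[OF finF(1,2), of q] sum.union_inter[OF finF(3,4), of q] 3(3,4) by simp
  ultimately show "surplus q E V (S1 \<union> S2) + surplus q E V (S1 \<inter> S2)
      \<le> surplus q E V S1 + surplus q E V S2"
    using u n 1(4) 2(4) by linarith
qed

end

section \<open>Existence of an SDR\<close>

text \<open>
  Among all sides of demanded edges, a side \<open>K\<close> containing the fewest demanded edges contains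
  none: the side of such an edge that faces away from \<open>e\<close>, cut down to \<open>K\<close>, would be smaller.
\<close>
lemma ex_leaf_edge:
  assumes E: "E \<subseteq> uedges T" "E \<noteq> {}"
  obtains e K where "e \<in> E" "isolates T K e" "\<And>f. f \<in> E \<Longrightarrow> f \<noteq> e \<Longrightarrow> f \<inter> K = {}"
proof -
  have finE: "finite E" using E(1) finite_edges finite_subset by blast
  define \<P> where "\<P> eK \<longleftrightarrow> fst eK \<in> E \<and> isolates T (snd eK) (fst eK)" for eK
  define m where "m eK = card {f \<in> E. f \<subseteq> snd eK}" for eK :: "'v set \<times> 'v set"
  obtain e0 where "e0 \<in> E" using E(2) by blast
  then obtain K0 where "isolates T K0 e0" using tree_edge_isolated[OF tree] E(1) by blast
  then have "\<P> (e0, K0)" using \<open>e0 \<in> E\<close> by (simp add: \<P>_def)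
  then obtain eK where eK: "\<P> eK" "\<And>eK'. \<P> eK' \<Longrightarrow> m eK \<le> m eK'"
    using ex_has_least_nat[of \<P> "(e0, K0)" m] by blast
  obtain e K where eK_eq: "eK = (e, K)" by (cases eK)
  have e: "e \<in> E" "isolates T K e" using eK(1) by (simp_all add: \<P>_def eK_eq)
  have "f \<inter> K = {}" if f: "f \<in> E" "f \<noteq> e" for f
  proof (rule ccontr)
    assume nonempty: "f \<inter> K \<noteq> {}"
    have fT: "f \<in> uedges T" and eT: "e \<in> uedges T" using f(1) e(1) E(1) by auto
    have fK: "f \<subseteq> K" using isolatesD[OF e(2) fT] nonempty f(2) by blast
    obtain L where L: "isolates T L f" using tree_edge_isolated[OF tree fT] by blast
    have "\<exists>L. isolates T L f \<and> e \<inter> L = {}"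
    proof (cases "e \<inter> L = {}")
      case False
      then have "e \<inter> - L = {}" using isolatesD[OF L eT] f(2) by blast
      then show ?thesis using L isolates_Compl by blast
    qed (use L in blast)
    then obtain L where L: "isolates T L f" "e \<inter> L = {}" by blast
    have cross_f: "f \<inter> L \<noteq> {}" "f - L \<noteq> {}" using isolatesD[OF L(1) fT] by auto
    have "(g \<inter> (K \<inter> L) \<noteq> {} \<and> g - K \<inter> L \<noteq> {}) \<longleftrightarrow> g = f" if g: "g \<in> uedges T" for g
    proof
      assume "g \<inter> (K \<inter> L) \<noteq> {} \<and> g - K \<inter> L \<noteq> {}"
      then have "g = e \<or> g = f" "g \<noteq> e"
        using isolatesD[OF e(2) g] isolatesD[OF L(1) g] L(2) by blast+
      then show "g = f" by blast
    next
      assume "g = f"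
      then show "g \<inter> (K \<inter> L) \<noteq> {} \<and> g - K \<inter> L \<noteq> {}" using cross_f fK by blast
    qed
    then have "\<P> (f, K \<inter> L)" using f(1) by (simp add: \<P>_def isolates_def)
    then have "m (e, K) \<le> m (f, K \<inter> L)" using eK(2) by (simp add: eK_eq)
    moreover have "{g \<in> E. g \<subseteq> K \<inter> L} \<subset> {g \<in> E. g \<subseteq> K}" using f(1) fK cross_f by blast
    then have "m (f, K \<inter> L) < m (e, K)"
      unfolding m_def using finE by (simp add: psubset_card_mono)
    ultimately show False by simp
  qed
  then show thesis using that e by blast
qed

definition partial_SDR :: "'v set set \<Rightarrow> 'x set \<Rightarrow> ('v set \<Rightarrow> nat) \<Rightarrow> ('v set \<Rightarrow> 'x set set) \<Rightarrow> bool" where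
  "partial_SDR E V q S \<longleftrightarrow>
     (\<forall>e\<in>E. S e \<subseteq> hedges (A e) \<and> \<Union>(S e) \<subseteq> V \<and> card (S e) = q e) \<and>
     (\<forall>e\<in>E. \<forall>f\<in>E. \<forall>a\<in>S e. \<forall>b\<in>S f. (e, a) \<noteq> (f, b) \<longrightarrow> disjnt a b)"

lemma partial_SDR_D:
  assumes "partial_SDR E V q S" "e \<in> E"
  shows "S e \<subseteq> hedges (A e)" "S e \<subseteq> Pow V" "card (S e) = q e"
    and "f \<in> E \<Longrightarrow> a \<in> S e \<Longrightarrow> b \<in> S f \<Longrightarrow> (e, a) \<noteq> (f, b) \<Longrightarrow> disjnt a b"
proof -
  have "S e \<subseteq> hedges (A e) \<and> \<Union>(S e) \<subseteq> V \<and> card (S e) = q e"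
    using assms unfolding partial_SDR_def by blast
  then show "S e \<subseteq> hedges (A e)" "S e \<subseteq> Pow V" "card (S e) = q e" by auto
  have "\<forall>f\<in>E. \<forall>a\<in>S e. \<forall>b\<in>S f. (e, a) \<noteq> (f, b) \<longrightarrow> disjnt a b"
    using assms unfolding partial_SDR_def by blast
  then show "f \<in> E \<Longrightarrow> a \<in> S e \<Longrightarrow> b \<in> S f \<Longrightarrow> (e, a) \<noteq> (f, b) \<Longrightarrow> disjnt a b" by blast
qed

text \<open>
  Induction on the number of edges; \<open>V\<close> varies because the resources used at the removed edge
  \<open>e = {t, l}\<close> are withheld from the others. Only \<open>W\<close>, their part in the bag of \<open>t\<close>, has to be
  withheld explicitly: the other edges lie on the far side of \<open>e\<close> and cannot reach a resource
  whose support contains \<open>l\<close> but not \<open>t\<close>.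
\<close>
theorem SDR_if_covers_large:
  assumes "E \<subseteq> uedges T" "V \<subseteq> U"
    and "\<And>F X. F \<subseteq> E \<Longrightarrow> covers A V F X \<Longrightarrow> sum q F \<le> card X"
  shows "\<exists>S. partial_SDR E V q S"
proof -
  have "finite E" using assms(1) finite_edges finite_subset by blast
  then show ?thesis using assms
  proof (induction "card E" arbitrary: E V)
    case 0
    then show ?case by (auto simp: partial_SDR_def)
  next
    case (Suc n)
    note ET = \<open>E \<subseteq> uedges T\<close> and VU = \<open>V \<subseteq> U\<close> and hall = Suc.prems(4)
    have finV: "finite V" using VU finite_resources finite_subset by blast
    have nonempty: "E \<noteq> {}" using Suc.hyps(2) by auto
    obtain e K where eE: "e \<in> E" and K: "isolates T K e"
      and out: "\<And>f. f \<in> E \<Longrightarrow> f \<noteq> e \<Longrightarrow> f \<inter> K = {}"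
      by (rule ex_leaf_edge[OF ET nonempty]) blast
    have eT: "e \<in> uedges T" using eE ET by blast
    define E0 where "E0 = E - {e}"
    have E0: "E0 \<subseteq> uedges T" "finite E0" "n = card E0" "e \<notin> E0" "E0 \<subseteq> E"
      using ET Suc.prems(1) Suc.hyps(2) eE by (auto simp: E0_def)
    obtain t l where tl: "e = {t, l}" "l \<in> K" "t \<notin> K"
    proof -
      obtain p r where pr: "e = {p, r}" by (rule edge_cases[OF simple eT])
      moreover have "e \<inter> K \<noteq> {}" "e - K \<noteq> {}" using isolatesD[OF K eT] by auto
      ultimately consider "p \<in> K" "r \<notin> K" | "r \<in> K" "p \<notin> K" by blast
      then show thesis using that[of p r] that[of r p] pr by cases (simp_all add: insert_commute)
    qed
    note tlT = eT[unfolded tl(1)]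
    define P where "P = {x \<in> V. t \<in> uverts (Q x)}"
    define I where "I = {x \<in> V. l \<in> uverts (Q x)}"
    \<comment> \<open>Each hyperedge chosen for \<open>e\<close> has the form \<open>{z, g z}\<close> with \<open>z\<close> in the bag of \<open>l\<close> and \<open>g z\<close>
      in the bag of \<open>t\<close>. An index \<open>z\<close> in both bags stands for the loop \<open>{z, z}\<close>; a pair would
      use up a further resource to no purpose.\<close>
    define B where "B z = (if z \<in> P then {z} else {x \<in> P. {x, z} \<in> hedges (A e)})" for z
    have fin: "finite P" "finite I" using finV by (auto simp: P_def I_def)
    define f where "f = surplus q E0 V"
    have hall0: "sum q F \<le> card X" if "F \<subseteq> E0" "covers A V F X" for F X
      using hall[OF _ that(2)] that(1) E0(5) by blast
    interpret rank_function P f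
      unfolding f_def
      by (rule surplus_rank_function[OF E0(1) VU hall0, where t = t]) (auto simp: P_def)
    have PV: "P \<subseteq> V" "I \<subseteq> V" by (auto simp: P_def I_def)
    have BP: "B z \<subseteq> P" for z by (auto simp: B_def)
    have rado_condition: "int (q e) + int (card J) \<le> f (\<Union>(B ` J)) + int (card I)" if J: "J \<subseteq> I" for J
    proof -
      have "\<Union>(B ` J) \<subseteq> V" using BP PV by blast
      then obtain F X where FX: "F \<subseteq> E0" "covers A V F X" "\<Union>(B ` J) \<subseteq> X"
          "f (\<Union>(B ` J)) = int (card X) - int (sum q F)"
        unfolding f_def by (rule surplus_attained[OF E0(1) VU])
      \<comment> \<open>Together with the indices outside \<open>J\<close>, a cover attaining the rank of \<open>\<Union>(B ` J)\<close> also covers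
        \<open>A e\<close>, so the hypothesis on covers, applied to \<open>insert e F\<close>, is the condition of Rado.\<close>
      have hit: "a \<inter> (X \<union> (I - J)) \<noteq> {}" if a: "a \<in> hedges (A e)" "a \<subseteq> V" for a
        using tlT a(1)[unfolded tl(1)]
      proof (cases rule: hyperedge_cases)
        case (loop x)
        then have "x \<in> I" "x \<in> P" using a(2) by (auto simp: I_def P_def)
        then have "x \<in> X \<or> x \<in> I - J" using FX(3) by (auto simp: B_def)
        then show ?thesis using loop(1) by blast
      next
        case (pair x y)
        then have xy: "y \<in> I" "x \<in> P" using a(2) by (auto simp: I_def P_def)
        consider "y \<notin> J" | "y \<in> J" "y \<in> P" | "y \<in> J" "y \<notin> P" by blast
        then show ?thesis
        proof cases
          case 1
          then show ?thesis using xy pair(1) by blast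
        next
          case 2
          then have "y \<in> B y" by (simp add: B_def)
          then show ?thesis using 2 FX(3) pair(1) by blast
        next
          case 3
          then have "x \<in> B y" using xy a(1) pair(1) by (simp add: B_def)
          then show ?thesis using 3 FX(3) pair(1) by blast
        qed
      qed
      have XV: "X \<subseteq> V" using FX(2) by (simp add: covers_def)
      have "covers A V (insert e F) (X \<union> (I - J))"
        unfolding covers_def
      proof (intro conjI ballI impI)
        show "X \<union> (I - J) \<subseteq> V" using XV PV by blast
        show "a \<inter> (X \<union> (I - J)) \<noteq> {}" if "g \<in> insert e F" "a \<in> hedges (A g)" "a \<subseteq> V" for g a
        proof (cases "g = e")
          case True
          then show ?thesis using hit that by simp
        next
          case False
          then have "a \<inter> X \<noteq> {}" using FX(2) that unfolding covers_def by blast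
          then show ?thesis by blast
        qed
      qed
      moreover have "insert e F \<subseteq> E" using FX(1) E0(5) eE by blast
      ultimately have "sum q (insert e F) \<le> card (X \<union> (I - J))" using hall by blast
      also have "\<dots> \<le> card X + card (I - J)" by (rule card_Un_le)
      finally have "sum q (insert e F) \<le> card X + card (I - J)" .
      moreover have "sum q (insert e F) = q e + sum q F"
        using FX(1) E0(2,4) by (intro sum.insert) (auto intro: finite_subset)
      moreover have "card (I - J) + card J = card I"
        using J fin(2) by (metis card_Diff_subset card_mono finite_subset le_add_diff_inverse2)
      ultimately show ?thesis using FX(4) by linarith
    qed
    have "\<exists>I'\<subseteq>I. \<exists>g. card I' = q e \<and> inj_on g I' \<and> (\<forall>z\<in>I'. g z \<in> B z) \<and> f (g ` I') = int (q e)"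
      by (rule rado_deficiency[OF fin(2) BP]) (rule rado_condition)
    then obtain I' g where I': "I' \<subseteq> I" "card I' = q e" "inj_on g I'" "\<forall>z\<in>I'. g z \<in> B z"
        "f (g ` I') = int (q e)"
      by (elim exE conjE)
    define W where "W = g ` I'"
    have WP: "W \<subseteq> P" using I'(4) BP by (auto simp: W_def)
    have cardW: "card W = q e" using I'(2,3) by (simp add: W_def card_image)
    have finW: "finite W" using WP fin(1) finite_subset by blast
    have "sum q F \<le> card X" if FX: "F \<subseteq> E0" "covers A (V - W) F X" for F X
    proof -
      have XV: "X \<subseteq> V - W" using FX(2) by (simp add: covers_def)
      have "a \<inter> (X \<union> W) \<noteq> {}" if "d \<in> F" "a \<in> hedges (A d)" "a \<subseteq> V" for d a
        using FX(2) that unfolding covers_def by blast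
      then have "covers A V F (X \<union> W)"
        using XV WP PV unfolding covers_def by blast
      then have "f W \<le> int (card (X \<union> W)) - int (sum q F)"
        unfolding f_def using FX(1) by (intro surplus_le[OF E0(1) VU]) auto
      moreover have "card (X \<union> W) \<le> card X + card W" by (rule card_Un_le)
      moreover have "f W = int (q e)" using I'(5) by (simp add: W_def)
      ultimately show ?thesis using cardW by linarith
    qed
    then obtain S0 where S0: "partial_SDR E0 (V - W) q S0"
      using Suc.hyps(1)[OF E0(3) E0(2) E0(1), of "V - W"] VU by blast
    define S where "S = S0(e := (\<lambda>z. {z, g z}) ` I')"
    have S0_dj: "a \<inter> {z, g z} = {}" if d: "d \<in> E0" "a \<in> S0 d" and z: "z \<in> I'" for d a z
    proof -
      have a: "a \<in> hedges (A d)" "a \<subseteq> V - W" using partial_SDR_D(1,2)[OF S0 d(1)] d(2) by blast+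
      have gz: "g z \<notin> a" using a(2) z by (auto simp: W_def)
      have "z \<notin> a"
      proof (cases "z \<in> P")
        case True
        then have "g z = z" using I'(4) z by (auto simp: B_def)
        then show ?thesis using gz by simp
      next
        case False
        have zz: "z \<in> U" "l \<in> uverts (Q z)" "t \<notin> uverts (Q z)"
          using z I'(1) False VU by (auto simp: I_def P_def)
        have "uverts (Q z) \<subseteq> K"
          using support_crosses[OF zz(1) K zz(2) _ tl(2)] tl(1) zz(3) by blast
        moreover have "d \<inter> K = {}" using out d(1) by (auto simp: E0_def)
        moreover have "d \<in> uedges T" using d(1) E0(1) by blast
        ultimately show ?thesis using hyperedge_facts(3)[OF _ a(1)] by blast
      qed
      then show ?thesis using gz by blast
    qed
    have pair_dj: "{z, g z} \<inter> {z', g z'} = {}" if z: "z \<in> I'" "z' \<in> I'" "z \<noteq> z'" for z z'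
    proof -
      \<comment> \<open>Otherwise \<open>w\<close> lies in both bags and \<open>g\<close> takes the value \<open>w\<close> at \<open>w\<close> as well as at \<open>w'\<close>.\<close>
      have *: "w \<noteq> g w'" if w: "w \<in> I'" "w' \<in> I'" "w \<noteq> w'" for w w'
      proof
        assume eq: "w = g w'"
        then have "w \<in> P" using I'(4) w(2) BP by blast
        then have "g w = w" using I'(4) w(1) by (auto simp: B_def)
        then show False using eq I'(3) w by (auto dest: inj_onD)
      qed
      have "g z \<noteq> g z'" using I'(3) z by (auto dest: inj_onD)
      then show ?thesis using *[OF z] *[OF z(2,1)] z(3) by auto
    qed
    have mem: "{z, g z} \<in> hedges (A e) \<and> {z, g z} \<subseteq> V" if z: "z \<in> I'" for z
    proof (cases "z \<in> P")
      case True
      then have "g z = z" using I'(4) z by (auto simp: B_def)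
      moreover have "z \<in> V" "t \<in> uverts (Q z)" "l \<in> uverts (Q z)"
        using True z I'(1) by (auto simp: P_def I_def)
      ultimately show ?thesis using loop_iff[OF tlT, of z] VU tl(1) by auto
    next
      case False
      then have "g z \<in> P" "{g z, z} \<in> hedges (A e)" using I'(4) z by (auto simp: B_def)
      then show ?thesis using z I'(1) PV by (auto simp: insert_commute)
    qed
    have "inj_on (\<lambda>z. {z, g z}) I'"
      using pair_dj by (intro inj_onI) (metis Int_absorb insert_not_empty)
    then have cardS: "card (S e) = q e" by (simp add: S_def card_image I'(2))
    have "partial_SDR E V q S"
      unfolding partial_SDR_def
    proof (intro conjI ballI impI)
      fix d assume d: "d \<in> E"
      have "S d \<subseteq> hedges (A d) \<and> \<Union>(S d) \<subseteq> V \<and> card (S d) = q d"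
      proof (cases "d = e")
        case True
        have "S e \<subseteq> hedges (A e)" "\<Union>(S e) \<subseteq> V" using mem by (auto simp: S_def)
        then show ?thesis using True cardS by simp
      next
        case False
        then have "d \<in> E0" "S d = S0 d" using d by (auto simp: E0_def S_def)
        then show ?thesis using partial_SDR_D(1-3)[OF S0, of d] by auto
      qed
      then show "S d \<subseteq> hedges (A d)" "\<Union>(S d) \<subseteq> V" "card (S d) = q d" by auto
    next
      fix d d' a b
      assume d: "d \<in> E" "d' \<in> E" and ab: "a \<in> S d" "b \<in> S d'" "(d, a) \<noteq> (d', b)"
      consider "d \<noteq> e" "d' \<noteq> e" | "d = e" "d' \<noteq> e" | "d \<noteq> e" "d' = e" | "d = e" "d' = e" by blast
      then show "disjnt a b"
      proof cases
        case 1
        then have "d \<in> E0" "d' \<in> E0" "a \<in> S0 d" "b \<in> S0 d'" using d ab by (auto simp: E0_def S_def)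
        then show ?thesis by (rule partial_SDR_D(4)[OF S0 _ _ _ _ ab(3)])
      next
        case 2
        then obtain z where "z \<in> I'" "a = {z, g z}" "b \<in> S0 d'" "d' \<in> E0"
          using d ab by (auto simp: E0_def S_def)
        then show ?thesis using S0_dj[of d' b z] by (auto simp: disjnt_def)
      next
        case 3
        then obtain z where "z \<in> I'" "b = {z, g z}" "a \<in> S0 d" "d \<in> E0"
          using d ab by (auto simp: E0_def S_def)
        then show ?thesis using S0_dj[of d a z] by (auto simp: disjnt_def)
      next
        case 4
        then obtain z z' where z: "z \<in> I'" "z' \<in> I'" "a = {z, g z}" "b = {z', g z'}"
          using ab by (auto simp: S_def)
        then have "z \<noteq> z'" using ab(3) 4 by auto
        then show ?thesis using pair_dj[OF z(1,2)] z(3,4) by (simp add: disjnt_def)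
      qed
    qed
    then show ?case by blast
  qed
qed

lemma is_SDR_iff_partial_SDR: "is_SDR T A q S \<longleftrightarrow> partial_SDR (uedges T) U q S"
proof -
  have "\<Union>(S e) \<subseteq> U" if "e \<in> uedges T" "S e \<subseteq> hedges (A e)" for e
    using that hyperedge_facts(2) by blast
  then show ?thesis
    by (force simp: is_SDR_def partial_SDR_def pairwise_def)
qed

lemma union_matching_finite:
  assumes "F \<subseteq> uedges T"
  shows "finite {M. matching (union_hypergraph U A F) M}"
proof -
  have "{M. matching (union_hypergraph U A F) M} \<subseteq> Pow (Pow U)"
    using assms hyperedge_facts(2) by (fastforce simp: matching_def union_hypergraph_def)
  then show ?thesis using finite_resources by (meson finite_Pow_iff finite_subset)
qed

text \<open>
  Weak duality: the hyperedges of a matching are disjoint, so each of them contains its own element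
  of the cover.
\<close>
lemma matching_number_le_cover:
  assumes F: "F \<subseteq> uedges T" and X: "covers A U F X"
  shows "matching_number (union_hypergraph U A F) \<le> card X"
proof -
  have XU: "X \<subseteq> U" using X by (simp add: covers_def)
  have le: "card M \<le> card X" if M: "matching (union_hypergraph U A F) M" for M
  proof -
    have hit: "a \<inter> X \<noteq> {}" if "a \<in> M" for a
    proof -
      obtain e where "e \<in> F" "a \<in> hedges (A e)"
        using M \<open>a \<in> M\<close> by (auto simp: matching_def union_hypergraph_def)
      then show ?thesis using X F hyperedge_facts(2)[of e a] by (auto simp: covers_def)
    qed
    define h where "h a = (SOME x. x \<in> a \<inter> X)" for a
    have h: "h a \<in> a \<inter> X" if "a \<in> M" for a
      unfolding h_def by (rule someI_ex) (use hit[OF that] in blast)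
    have "a = b" if ab: "a \<in> M" "b \<in> M" "h a = h b" for a b
    proof (rule ccontr)
      assume "a \<noteq> b"
      then have "disjnt a b" using M ab by (auto simp: matching_def pairwise_def)
      then show False using h[OF ab(1)] h[OF ab(2)] ab(3) by (auto simp: disjnt_def)
    qed
    then have "inj_on h M" by (rule inj_onI)
    moreover have "h ` M \<subseteq> X" using h by auto
    ultimately show ?thesis
      using card_inj_on_le XU finite_resources finite_subset by metis
  qed
  have "matching (union_hypergraph U A F) {}" by (simp add: matching_def)
  then have "card ` {M. matching (union_hypergraph U A F) M} \<noteq> {}" by blast
  then show ?thesis
    unfolding matching_number_def
    using union_matching_finite[OF F] le by (subst Max_le_iff) auto
qed

lemma SDR_imp_hall:
  assumes S: "partial_SDR (uedges T) U q S" and F: "F \<subseteq> uedges T"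
  shows "sum q F \<le> matching_number (union_hypergraph U A F)"
proof -
  have mem: "S e \<subseteq> hedges (A e)" "card (S e) = q e" if "e \<in> F" for e
    using partial_SDR_D(1,3)[OF S] F that by blast+
  have dj: "disjnt a b" if "e \<in> F" "f \<in> F" "a \<in> S e" "b \<in> S f" "(e, a) \<noteq> (f, b)" for e f a b
    using partial_SDR_D(4)[OF S _ _ that(3-5)] F that(1,2) by blast
  have finS: "finite (S e)" if "e \<in> F" for e
  proof -
    have "S e \<subseteq> Pow U" using partial_SDR_D(2)[OF S] F that by blast
    then show ?thesis using finite_resources by (meson finite_Pow_iff finite_subset)
  qed
  have finF: "finite F" using F finite_edges finite_subset by blast
  have "S e \<inter> S f = {}" if ef: "e \<in> F" "f \<in> F" "e \<noteq> f" for e f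
  proof (rule ccontr)
    assume "S e \<inter> S f \<noteq> {}"
    then obtain a where a: "a \<in> S e" "a \<in> S f" by blast
    then have "a = {}" using dj[OF ef(1,2) a] ef(3) by simp
    then show False using hyperedge_facts(1)[of e a] mem(1)[OF ef(1)] a(1) F ef(1) by blast
  qed
  then have "card (\<Union>(S ` F)) = (\<Sum>e\<in>F. card (S e))"
    using finS finF by (simp add: card_UN_disjoint)
  then have card: "card (\<Union>(S ` F)) = sum q F" using mem(2) by simp
  have "\<Union>(S ` F) \<subseteq> hedges (union_hypergraph U A F)"
    using mem(1) by (auto simp: union_hypergraph_def)
  moreover have "pairwise disjnt (\<Union>(S ` F))"
    using dj by (auto simp: pairwise_def)
  ultimately have "matching (union_hypergraph U A F) (\<Union>(S ` F))" by (simp add: matching_def)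
  then show ?thesis
    unfolding matching_number_def card[symmetric]
    using union_matching_finite[OF F] by (intro Max_ge) auto
qed

theorem SDR_iff_hall:
  "(\<exists>S. is_SDR T A q S) \<longleftrightarrow>
    (\<forall>F\<subseteq>uedges T. sum q F \<le> matching_number (union_hypergraph U A F))"
proof
  assume "\<exists>S. is_SDR T A q S"
  then show "\<forall>F\<subseteq>uedges T. sum q F \<le> matching_number (union_hypergraph U A F)"
    using SDR_imp_hall is_SDR_iff_partial_SDR by blast
next
  assume hall: "\<forall>F\<subseteq>uedges T. sum q F \<le> matching_number (union_hypergraph U A F)"
  have "sum q F \<le> card X" if "F \<subseteq> uedges T" "covers A U F X" for F X
    using hall that matching_number_le_cover[OF that] le_trans by blast
  then have "\<exists>S. partial_SDR (uedges T) U q S"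
    by (intro SDR_if_covers_large) auto
  then show "\<exists>S. is_SDR T A q S" by (simp add: is_SDR_iff_partial_SDR)
qed

section \<open>Perfect matchings of the extended hypergraph\<close>

text \<open>
  Number the hyperedges chosen for \<open>e\<close> from \<open>1\<close> to \<open>q e\<close> and attach the \<open>i\<close>-th one to \<open>New e i\<close>;
  the resources left over are covered by loops.
\<close>
lemma perfect_matching_if_SDR:
  assumes S: "partial_SDR (uedges T) U q S"
  shows "\<exists>M. perfect_matching (H_hypergraph T U A q) M"
proof -
  let ?N = "SIGMA e:uedges T. {1..q e}"
  have ex: "\<exists>h. bij_betw h {1..q e} (S e)" if e: "e \<in> uedges T" for e
  proof -
    have "finite (S e)"
      using partial_SDR_D(2)[OF S e] finite_resources by (meson finite_Pow_iff finite_subset)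
    then show ?thesis using partial_SDR_D(3)[OF S e] by (intro finite_same_card_bij) auto
  qed
  define h where "h e = (SOME h. bij_betw h {1..q e} (S e))" for e
  have h: "bij_betw (h e) {1..q e} (S e)" if "e \<in> uedges T" for e
    unfolding h_def by (rule someI_ex[OF ex[OF that]])
  have hS: "h e i \<in> S e" if "(e, i) \<in> ?N" for e i
    using h[of e] that by (auto simp: bij_betw_def)
  have hA: "h e i \<in> hedges (A e)" "h e i \<subseteq> U" if "(e, i) \<in> ?N" for e i
    using hS[OF that] partial_SDR_D(1,2)[OF S, of e] that by blast+
  have dj: "h e i \<inter> h e' i' = {}" if N: "(e, i) \<in> ?N" "(e', i') \<in> ?N" "(e, i) \<noteq> (e', i')" for e i e' i'
  proof -
    have "(e, h e i) \<noteq> (e', h e' i')"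
    proof
      assume eq: "(e, h e i) = (e', h e' i')"
      then have "i = i'" using h[of e] N by (auto simp: bij_betw_def dest: inj_onD)
      then show False using eq N(3) by simp
    qed
    then have "disjnt (h e i) (h e' i')"
      using partial_SDR_D(4)[OF S _ _ hS[OF N(1)] hS[OF N(2)]] N(1,2) by blast
    then show ?thesis by (simp add: disjnt_def)
  qed
  define z where "z = (\<lambda>(e, i). insert (New e i) (Res ` h e i))"
  define rest where "rest = {x \<in> U. \<forall>(e, i)\<in>?N. x \<notin> h e i}"
  define M where "M = z ` ?N \<union> (\<lambda>x. {Res x}) ` rest"
  have "M \<subseteq> hedges (H_hypergraph T U A q)"
    using hA(1) by (fastforce simp: M_def z_def rest_def H_hypergraph_def)
  moreover have "pairwise disjnt M"
  proof (rule pairwiseI)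
    fix a b assume ab: "a \<in> M" "b \<in> M" "a \<noteq> b"
    have zz: "disjnt (z p) (z p')" if "p \<in> ?N" "p' \<in> ?N" "z p \<noteq> z p'" for p p'
    proof -
      obtain e i e' i' where p: "p = (e, i)" "p' = (e', i')" by (cases p, cases p')
      then have ne: "(e, i) \<noteq> (e', i')" using that(3) by blast
      have "h e i \<inter> h e' i' = {}" by (rule dj) (use that p ne in blast)+
      with ne show ?thesis unfolding p z_def disjnt_def by auto
    qed
    have zr: "disjnt (z p) {Res x}" if "p \<in> ?N" "x \<in> rest" for p x
      using that by (auto simp: z_def rest_def disjnt_def)
    have half: "disjnt a b" if ab': "a \<in> z ` ?N" "b \<in> M" "a \<noteq> b" for a b
    proof (cases "b \<in> z ` ?N")
      case True
      obtain p where p: "a = z p" "p \<in> ?N" using ab'(1) by (rule imageE)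
      obtain p' where p': "b = z p'" "p' \<in> ?N" using True by (rule imageE)
      show ?thesis using zz[OF p(2) p'(2)] ab'(3) unfolding p(1) p'(1) .
    next
      case False
      obtain p where p: "a = z p" "p \<in> ?N" using ab'(1) by (rule imageE)
      obtain x where x: "x \<in> rest" "b = {Res x}" using ab'(2) False unfolding M_def by blast
      show ?thesis unfolding p(1) x(2) by (rule zr[OF p(2) x(1)])
    qed
    show "disjnt a b"
    proof (cases "a \<in> z ` ?N \<or> b \<in> z ` ?N")
      case True
      then show ?thesis using half[OF _ ab(2,3)] disjnt_sym[OF half[OF _ ab(1) ab(3)[symmetric]]] by blast
    next
      case False
      obtain x where "a = {Res x}" using False ab(1) by (auto simp: M_def)
      moreover obtain y where "b = {Res y}" using False ab(2) by (auto simp: M_def)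
      ultimately show ?thesis using ab(3) by (simp add: disjnt_def)
    qed
  qed
  moreover have "\<Union>M = hverts (H_hypergraph T U A q)"
  proof -
    have "\<Union>M \<subseteq> Res ` U \<union> {New e i |e i. e \<in> uedges T \<and> i \<in> {1..q e}}"
      using hA(2) by (fastforce simp: M_def z_def rest_def)
    moreover have "Res x \<in> \<Union>M" if x: "x \<in> U" for x
    proof (cases "x \<in> rest")
      case False
      then obtain e i where "(e, i) \<in> ?N" "x \<in> h e i" using x by (auto simp: rest_def)
      then show ?thesis unfolding M_def by (intro UnionI[of "z (e, i)"]) (auto simp: z_def)
    qed (auto simp: M_def)
    moreover have "New e i \<in> \<Union>M" if "(e, i) \<in> ?N" for e i
      using that unfolding M_def by (intro UnionI[of "z (e, i)"]) (auto simp: z_def)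
    ultimately show ?thesis by (auto simp: H_hypergraph_def)
  qed
  ultimately show ?thesis by (auto simp: perfect_matching_def matching_def)
qed

text \<open>
  The hyperedges of the matching at \<open>New e i\<close> and at \<open>New e j\<close> leave disjoint and nonempty sets of
  resources, so the choices for \<open>e\<close> really are \<open>q e\<close> many.
\<close>
lemma SDR_if_perfect_matching:
  assumes M: "perfect_matching (H_hypergraph T U A q) M"
  shows "\<exists>S. partial_SDR (uedges T) U q S"
proof -
  let ?N = "SIGMA e:uedges T. {1..q e}"
  have Mh: "M \<subseteq> hedges (H_hypergraph T U A q)" and MU: "\<Union>M = hverts (H_hypergraph T U A q)"
    and Mdj: "\<And>a b. a \<in> M \<Longrightarrow> b \<in> M \<Longrightarrow> a \<noteq> b \<Longrightarrow> a \<inter> b = {}"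
    using M by (auto simp: perfect_matching_def matching_def pairwise_def disjnt_def)
  have ex: "\<exists>a. a \<in> hedges (A e) \<and> insert (New e i) (Res ` a) \<in> M" if "(e, i) \<in> ?N" for e i
  proof -
    have "New e i \<in> \<Union>M" unfolding MU using that by (auto simp: H_hypergraph_def)
    then obtain b where b: "b \<in> M" "New e i \<in> b" by blast
    then have "b \<in> hedges (H_hypergraph T U A q)" using Mh by blast
    then show ?thesis using b by (auto simp: H_hypergraph_def)
  qed
  define h where "h e i = (SOME a. a \<in> hedges (A e) \<and> insert (New e i) (Res ` a) \<in> M)" for e i
  have h: "h e i \<in> hedges (A e)" "insert (New e i) (Res ` h e i) \<in> M" if "(e, i) \<in> ?N" for e i
    using someI_ex[OF ex[OF that]] unfolding h_def by blast+
  have dj: "h e i \<inter> h e' i' = {}" if N: "(e, i) \<in> ?N" "(e', i') \<in> ?N" "(e, i) \<noteq> (e', i')" for e i e' i'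
  proof -
    have "insert (New e i) (Res ` h e i) \<noteq> insert (New e' i') (Res ` h e' i')" using N(3) by auto
    from Mdj[OF h(2)[OF N(1)] h(2)[OF N(2)] this] show ?thesis by auto
  qed
  define S where "S e = h e ` {1..q e}" for e
  have "partial_SDR (uedges T) U q S"
    unfolding partial_SDR_def
  proof (intro conjI ballI impI)
    fix e assume e: "e \<in> uedges T"
    show sub: "S e \<subseteq> hedges (A e)" using h(1) e by (auto simp: S_def)
    then show "\<Union>(S e) \<subseteq> U" using hyperedge_facts(2)[OF e] by blast
    have "inj_on (h e) {1..q e}"
    proof (rule inj_onI, rule ccontr)
      fix i j assume ij: "i \<in> {1..q e}" "j \<in> {1..q e}" "h e i = h e j" "i \<noteq> j"
      then have "h e i = {}" using dj[of e i e j] e by auto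
      then show False using hyperedge_facts(1)[OF e h(1)[of e i]] ij(1) e by simp
    qed
    then show "card (S e) = q e" by (simp add: S_def card_image)
  next
    fix e f a b
    assume ef: "e \<in> uedges T" "f \<in> uedges T" "a \<in> S e" "b \<in> S f" "(e, a) \<noteq> (f, b)"
    obtain i where i: "i \<in> {1..q e}" "a = h e i" using ef(3) unfolding S_def by blast
    obtain j where j: "j \<in> {1..q f}" "b = h f j" using ef(4) unfolding S_def by blast
    have "(e, i) \<noteq> (f, j)" using ef(5) i(2) j(2) by blast
    then have "h e i \<inter> h f j = {}" using dj ef(1,2) i(1) j(1) by blast
    then show "disjnt a b" using i(2) j(2) by (simp add: disjnt_def)
  qed
  then show ?thesis by blast
qed

end

theorem theorem1p1:
  fixes T :: "'v ugraph"
    and U :: "'x set"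
    and Q :: "'x \<Rightarrow> 'v ugraph"
    and A :: "'v set \<Rightarrow> 'x hypergraph"
    and q :: "'v set \<Rightarrow> nat"
  assumes "finite_tree T"
    and "finite U"
    and "\<And>x. x \<in> U \<Longrightarrow> is_subtree (Q x) T"
    and "tree_structured_system T U Q A"
    and "\<And>e. e \<in> uedges T \<Longrightarrow> q e > 0"
  shows "((\<exists>S. is_SDR T A q S) \<longleftrightarrow> (\<exists>M. perfect_matching (H_hypergraph T U A q) M)) \<and>
         ((\<exists>M. perfect_matching (H_hypergraph T U A q) M) \<longleftrightarrow>
            (\<forall>F\<subseteq>uedges T. matching_number (union_hypergraph U A F) \<ge> (\<Sum>e\<in>F. q e)))"
proof -
  interpret tree_system T U Q A
    by unfold_locales (fact assms)+
  have "(\<exists>S. is_SDR T A q S) \<longleftrightarrow> (\<exists>M. perfect_matching (H_hypergraph T U A q) M)"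
    using perfect_matching_if_SDR SDR_if_perfect_matching is_SDR_iff_partial_SDR by blast
  then show ?thesis using SDR_iff_hall by blast
qed

end
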